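(* Let $(\boldsymbol{x},\boldsymbol{\nu}_1,\boldsymbol{\nu}_2):U\to H^3\times\Delta_5$ be a hyperbolic generalized framed surface, let $\boldsymbol{\nu}_3=\boldsymbol{x}\wedge\boldsymbol{\nu}_1\wedge\boldsymbol{\nu}_2$, and let $i\in\{2,3,4\}$. If $\boldsymbol{\pi}_i\circ\boldsymbol{\nu}_3(u,v)$ is spacelike for all $(u,v)\in U$, then $\widetilde{\boldsymbol{x}}=\boldsymbol{\pi}_i\circ\boldsymbol{x}:U\to\mathbb{R}^3_1$ is a lightcone framed base surface.
   Context: $\mathbb{R}^n_1$ is $\mathbb{R}^n$ with the pseudo inner product $\langle \boldsymbol{x},\boldsymbol{y}\rangle=-x_1y_1+\sum_{j=2}^n x_jy_j$. For $n=4$, the pseudo vector product $\boldsymbol{x}\wedge\boldsymbol{y}\wedge\boldsymbol{z}$ is the unique vector of $\mathbb{R}^4_1$ with $\langle \boldsymbol{w},\boldsymbol{x}\wedge\boldsymbol{y}\wedge\boldsymbol{z}\rangle=\det(\boldsymbol{w},\boldsymbol{x},\boldsymbol{y},\boldsymbol{z})$ for all $\boldsymbol{w}$; for $n=3$, $\boldsymbol{x}\wedge\boldsymbol{y}$ is the unique vector of $\mathbb{R}^3_1$ with $\langle \boldsymbol{w},\boldsymbol{x}\wedge\boldsymbol{y}\rangle=\det(\boldsymbol{w},\boldsymbol{x},\boldsymbol{y})$ for all $\boldsymbol{w}$. A nonzero vector $\boldsymbol{x}$ is spacelike if $\langle\boldsymbol{x},\boldsymbol{x}\rangle>0$. $H^3=\{\boldsymbol{x}\in\mathbb{R}^4_1: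 \langle\boldsymbol{x},\boldsymbol{x}\rangle=-1,\ x_1>0\}$, $S^3_1=\{\boldsymbol{x}\in\mathbb{R}^4_1:\langle\boldsymbol{x},\boldsymbol{x}\rangle=1\}$, $\Delta_5=\{(\boldsymbol{\nu}_1,\boldsymbol{\nu}_2)\in S^3_1\times S^3_1:\langle\boldsymbol{\nu}_1,\boldsymbol{\nu}_2\rangle=0\}$. $U$ is a simply connected open subset of $\mathbb{R}^2$ with coordinates $(u,v)$; subscripts $u,v$ denote partial derivatives; all maps are $C^\infty$. Hyperbolic generalized framed surface: a smooth map $(\boldsymbol{x},\boldsymbol{\nu}_1,\boldsymbol{\nu}_2):U\to H^3\times\Delta_5$ with $\langle\boldsymbol{x},\boldsymbol{\nu}_1\rangle=\langle\boldsymbol{x},\boldsymbol{\nu}_2\rangle=0$ on $U$ for which there are smooth functions $\alpha,\beta:U\to\mathbb{R}$ with $\boldsymbol{x}\wedge\boldsymbol{x}_u\wedge\boldsymbol{x}_v=\alpha\boldsymbol{\nu}_1+\beta\boldsymbol{\nu}_2$ on $U$. The projections $\boldsymbol{\pi}_i$ (applied to vectors of $\mathbb{R}^4_1$, with values in $\mathbb{R}^3_1$) are $\boldsymbol{\pi}_2(x_1,x_2,x_3,x_4)=(x_1,x_3,x_4)$, $\boldsymbol{\pi}_3(x_1,x_2,x_3,x_4)=(x_1,x_2,x_4)$, $\boldsymbol{\pi}_4(x_1,x_2,x_3,x_4)=(x_1,x_2,x_3)$. Let $LC^*=\{\boldsymbol{x}\in\mathbb{R}^3_1\setminus\{\boldsymbol{0}\}:\langle\boldsymbol{x},\boldsymbol{x}\rangle=0\}$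 and $\Delta_4=\{(\boldsymbol{\nu}_1,\boldsymbol{\nu}_2)\in LC^*\times LC^*:\langle\boldsymbol{\nu}_1,\boldsymbol{\nu}_2\rangle=-2\}$. A smooth map $(\widetilde{\boldsymbol{x}},\boldsymbol{\ell}^+,\boldsymbol{\ell}^-):U\to\mathbb{R}^3_1\times\Delta_4$ is a lightcone framed surface if there are smooth functions $\widetilde{\alpha},\widetilde{\beta}:U\to\mathbb{R}$ with $\widetilde{\boldsymbol{x}}_u\wedge\widetilde{\boldsymbol{x}}_v=\widetilde{\alpha}\boldsymbol{\ell}^++\widetilde{\beta}\boldsymbol{\ell}^-$ on $U$; a smooth map $\widetilde{\boldsymbol{x}}:U\to\mathbb{R}^3_1$ is a lightcone framed base surface if there is a smooth $(\boldsymbol{\ell}^+,\boldsymbol{\ell}^-):U\to\Delta_4$ such that $(\widetilde{\boldsymbol{x}},\boldsymbol{\ell}^+,\boldsymbol{\ell}^-)$ is a lightcone framed surface. *)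

theory Defs
  imports "HOL-Analysis.Analysis"
begin

text \<open>Intended for open sets. At successor stages every directional derivative is required to be
  differentiable one order less.\<close>

primrec Ck_on :: "nat \<Rightarrow> 'a::real_normed_vector set \<Rightarrow> ('a \<Rightarrow> 'b::real_normed_vector) \<Rightarrow> bool" where
  "Ck_on 0 S f \<longleftrightarrow> continuous_on S f"
| "Ck_on (Suc k) S f \<longleftrightarrow>
     (\<forall>p\<in>S. f differentiable (at p)) \<and> (\<forall>v. Ck_on k S (\<lambda>p. frechet_derivative f (at p) v))"

definition smooth_on :: "'a::real_normed_vector set \<Rightarrow> ('a \<Rightarrow> 'b::real_normed_vector) \<Rightarrow> bool" where
  "smooth_on S f \<longleftrightarrow> (\<forall>k. Ck_on k S f)"

definition partial_deriv :: "'n::finite \<Rightarrow> (real^'n \<Rightarrow> 'b::real_normed_vector) \<Rightarrow> real^'n \<Rightarrow> 'b" where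
  "partial_deriv i f p = vector_derivative (\<lambda>t. f (p + t *\<^sub>R axis i 1)) (at 0)"

abbreviation deriv_u :: "(real^2 \<Rightarrow> 'b::real_normed_vector) \<Rightarrow> real^2 \<Rightarrow> 'b" where
  "deriv_u \<equiv> partial_deriv 1"

abbreviation deriv_v :: "(real^2 \<Rightarrow> 'b::real_normed_vector) \<Rightarrow> real^2 \<Rightarrow> 'b" where
  "deriv_v \<equiv> partial_deriv 2"

definition pinner :: "real^'n::{finite,one} \<Rightarrow> real^'n::{finite,one} \<Rightarrow> real" where
  "pinner x y = - x$1 * y$1 + (\<Sum>j\<in>UNIV - {1}. x$j * y$j)"

definition pwedge4 :: "real^4 \<Rightarrow> real^4 \<Rightarrow> real^4 \<Rightarrow> real^4" where
  "pwedge4 x y z = (THE q. \<forall>w. pinner w q = det (vector [w, x, y, z] :: real^4^4))"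

definition pwedge3 :: "real^3 \<Rightarrow> real^3 \<Rightarrow> real^3" where
  "pwedge3 x y = (THE q. \<forall>w. pinner w q = det (vector [w, x, y] :: real^3^3))"

text \<open>The descriptions above are well-defined.\<close>

lemma pinner_represents:
  fixes f :: "real^'n::{finite,one} \<Rightarrow> real"
  assumes "linear f"
  shows "\<exists>!q. \<forall>w. pinner w q = f w"
proof -
  define s :: "'n \<Rightarrow> real" where "s i = (if i = 1 then -1 else 1)" for i
  have pin: "pinner w q = (\<Sum>i\<in>UNIV. w$i * (s i * q$i))" for w q :: "real^'n::{finite,one}"
    by (simp add: pinner_def sum.remove[of UNIV 1] s_def)
  have ax: "pinner (axis j 1) q = s j * q$j" for j and q :: "real^'n::{finite,one}"
  proof -
    have "pinner (axis j 1) q = (\<Sum>i\<in>UNIV. if i = j then s j * q$j else 0)"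
      unfolding pin by (rule sum.cong) (auto simp: axis_def)
    then show ?thesis by simp
  qed
  have ss: "s i * s i = 1" and s0: "s i \<noteq> 0" for i by (auto simp: s_def)
  have f_eq: "f w = (\<Sum>i\<in>UNIV. w$i * f (axis i 1))" for w
  proof -
    have "w = (\<Sum>i\<in>UNIV. w$i *\<^sub>R axis i 1)"
      using basis_expansion[of w] by (simp add: scalar_mult_eq_scaleR)
    then have "f w = f (\<Sum>i\<in>UNIV. w$i *\<^sub>R axis i 1)" by simp
    also have "\<dots> = (\<Sum>i\<in>UNIV. w$i * f (axis i 1))"
      using assms by (simp add: linear_sum linear_cmul)
    finally show ?thesis .
  qed
  show ?thesis
  proof (rule ex1I[of _ "\<chi> i. s i * f (axis i 1)"])
    show "\<forall>w. pinner w (\<chi> i. s i * f (axis i 1)) = f w"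
    proof
      fix w
      have "s i * (s i * c) = c" for i and c :: real by (simp add: s_def)
      then show "pinner w (\<chi> i. s i * f (axis i 1)) = f w"
        by (simp only: pin vec_lambda_beta f_eq[of w])
    qed
  next
    fix q assume q: "\<forall>w. pinner w q = f w"
    have "q$i = s i * f (axis i 1)" for i
    proof -
      have "s i * q$i = f (axis i 1)" using q ax by metis
      then show ?thesis by (metis ss mult.assoc mult_1)
    qed
    then show "q = (\<chi> i. s i * f (axis i 1))" by (simp add: vec_eq_iff)
  qed
qed

text \<open>In the index type \<open>4\<close> the numeral \<open>4\<close> equals \<open>0\<close>; \<open>x$4\<close> is nevertheless the last coordinate.\<close>

lemma vector_4:
  "(vector [a, b, c, d] :: 'a::zero^4)$1 = a"
  "(vector [a, b, c, d] :: 'a::zero^4)$2 = b"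
  "(vector [a, b, c, d] :: 'a::zero^4)$3 = c"
  "(vector [a, b, c, d] :: 'a::zero^4)$4 = d"
  by (simp_all add: vector_def)

lemma linear_det_row1:
  fixes R :: "'n::{finite,one} \<Rightarrow> real^'n::{finite,one}"
  shows "linear (\<lambda>w. det (\<chi> i. if i = 1 then w else R i))"
  by (rule linearI) (simp_all only: det_row_add det_row_mul scalar_mult_eq_scaleR[symmetric] real_scaleR_def)

lemma pinner_pwedge4: "pinner w (pwedge4 x y z) = det (vector [w, x, y, z] :: real^4^4)"
proof -
  have "vector [w, x, y, z] = (\<chi> i. if i = 1 then w else (vector [0, x, y, z] :: real^4^4) $ i)" for w
    by (simp add: vec_eq_iff forall_4 vector_4)
  then have "linear (\<lambda>w. det (vector [w, x, y, z] :: real^4^4))"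
    using linear_det_row1[of "\<lambda>i. (vector [0, x, y, z] :: real^4^4) $ i"] by simp
  from theI'[OF pinner_represents[OF this]] show ?thesis
    unfolding pwedge4_def by blast
qed

lemma pinner_pwedge3: "pinner w (pwedge3 x y) = det (vector [w, x, y] :: real^3^3)"
proof -
  have "vector [w, x, y] = (\<chi> i. if i = 1 then w else (vector [0, x, y] :: real^3^3) $ i)" for w
    by (simp add: vec_eq_iff forall_3)
  then have "linear (\<lambda>w. det (vector [w, x, y] :: real^3^3))"
    using linear_det_row1[of "\<lambda>i. (vector [0, x, y] :: real^3^3) $ i"] by simp
  from theI'[OF pinner_represents[OF this]] show ?thesis
    unfolding pwedge3_def by blast
qed

definition spacelike :: "real^'n::{finite,one} \<Rightarrow> bool" where
  "spacelike x \<longleftrightarrow> x \<noteq> 0 \<and> pinner x x > 0"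

definition H3 :: "(real^4) set" where
  "H3 = {x. pinner x x = -1 \<and> x$1 > 0}"

definition S31 :: "(real^4) set" where
  "S31 = {x. pinner x x = 1}"

definition Delta5 :: "((real^4) \<times> (real^4)) set" where
  "Delta5 = {(n1, n2). n1 \<in> S31 \<and> n2 \<in> S31 \<and> pinner n1 n2 = 0}"

definition LCstar :: "(real^3) set" where
  "LCstar = {x. x \<noteq> 0 \<and> pinner x x = 0}"

definition Delta4 :: "((real^3) \<times> (real^3)) set" where
  "Delta4 = {(n1, n2). n1 \<in> LCstar \<and> n2 \<in> LCstar \<and> pinner n1 n2 = -2}"

text \<open>Only meaningful for \<open>i \<in> {2, 3, 4}\<close>: the \<open>i\<close>-th coordinate is dropped.\<close>

definition mproj :: "nat \<Rightarrow> real^4 \<Rightarrow> real^3" where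
  "mproj i x =
    (if i = 2 then vector [x$1, x$3, x$4]
     else if i = 3 then vector [x$1, x$2, x$4]
     else if i = 4 then vector [x$1, x$2, x$3]
     else undefined)"

definition hyperbolic_gen_framed_surface ::
    "(real^2) set \<Rightarrow> (real^2 \<Rightarrow> real^4) \<Rightarrow> (real^2 \<Rightarrow> real^4) \<Rightarrow> (real^2 \<Rightarrow> real^4) \<Rightarrow> bool" where
  "hyperbolic_gen_framed_surface U x \<nu>1 \<nu>2 \<longleftrightarrow>
     smooth_on U x \<and> smooth_on U \<nu>1 \<and> smooth_on U \<nu>2 \<and>
     (\<forall>p\<in>U. x p \<in> H3 \<and> (\<nu>1 p, \<nu>2 p) \<in> Delta5) \<and>
     (\<forall>p\<in>U. pinner (x p) (\<nu>1 p) = 0 \<and> pinner (x p) (\<nu>2 p) = 0) \<and>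
     (\<exists>\<alpha> \<beta> :: real^2 \<Rightarrow> real. smooth_on U \<alpha> \<and> smooth_on U \<beta> \<and>
        (\<forall>p\<in>U. pwedge4 (x p) (deriv_u x p) (deriv_v x p) = \<alpha> p *\<^sub>R \<nu>1 p + \<beta> p *\<^sub>R \<nu>2 p))"

definition lightcone_framed_surface ::
    "(real^2) set \<Rightarrow> (real^2 \<Rightarrow> real^3) \<Rightarrow> (real^2 \<Rightarrow> real^3) \<Rightarrow> (real^2 \<Rightarrow> real^3) \<Rightarrow> bool" where
  "lightcone_framed_surface U x lp lm \<longleftrightarrow>
     smooth_on U x \<and> smooth_on U lp \<and> smooth_on U lm \<and>
     (\<forall>p\<in>U. (lp p, lm p) \<in> Delta4) \<and>
     (\<exists>\<alpha> \<beta> :: real^2 \<Rightarrow> real. smooth_on U \<alpha> \<and> smooth_on U \<beta> \<and>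
        (\<forall>p\<in>U. pwedge3 (deriv_u x p) (deriv_v x p) = \<alpha> p *\<^sub>R lp p + \<beta> p *\<^sub>R lm p))"

definition lightcone_framed_base_surface :: "(real^2) set \<Rightarrow> (real^2 \<Rightarrow> real^3) \<Rightarrow> bool" where
  "lightcone_framed_base_surface U x \<longleftrightarrow> (\<exists>lp lm. lightcone_framed_surface U x lp lm)"

end

theory Submission
  imports Defs
begin

text \<open>The vectors \<open>x\<close>, \<open>\<nu>\<^sub>1\<close>, \<open>\<nu>\<^sub>2\<close>, \<open>\<nu>\<^sub>3\<close> are pairwise orthogonal, and \<open>x \<and> x\<^sub>u \<and> x\<^sub>v\<close> is a combination of
  \<open>\<nu>\<^sub>1\<close> and \<open>\<nu>\<^sub>2\<close>, hence orthogonal to \<open>\<nu>\<^sub>3\<close>: the vectors \<open>\<nu>\<^sub>3\<close>, \<open>x\<close>, \<open>x\<^sub>u\<close>, \<open>x\<^sub>v\<close> are linearly dependent.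
  Since \<open>x\<close> is timelike and orthogonal to the other three, already \<open>\<nu>\<^sub>3\<close>, \<open>x\<^sub>u\<close>, \<open>x\<^sub>v\<close> are dependent,
  and so are their images under \<open>\<pi>\<^sub>i\<close> (lemma \<open>det3_image_eq_0\<close>). Therefore the normal of the projected
  surface is everywhere orthogonal to \<open>n = \<pi>\<^sub>i \<circ> \<nu>\<^sub>3\<close>.

  If \<open>n\<close> is spacelike, its orthogonal complement is a Lorentzian plane with exactly two lightlike
  directions. A choice of \<open>l\<^sup>+\<close> and \<open>l\<^sup>-\<close> in them spans a plane that contains the normal
  (\<open>frame_expansion\<close>). An orthonormal frame of the complement given by explicit formulas in \<open>n\<close>
  shows that the choice can be made globally and smoothly (\<open>smooth_on_frame\<close>). The coefficients of
  the normal are pseudo inner products with \<open>l\<^sup>+\<close> and \<open>l\<^sup>-\<close>, so they are smooth, too.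

  What remains is that the formulas involved preserve smoothness; this is established order by
  order.\<close>

section \<open>Calculus of \<open>C\<^sup>k\<close> maps on open sets\<close>

lemma Ck_on_Suc_has_derivative:
  assumes "Ck_on (Suc k) S f" "p \<in> S"
  shows "(f has_derivative frechet_derivative f (at p)) (at p)"
  using assms frechet_derivative_works by auto

lemma Ck_on_cong:
  assumes "open S" "Ck_on k S f" "\<And>p. p \<in> S \<Longrightarrow> f p = g p"
  shows "Ck_on k S g"
  using assms(2,3)
proof (induction k arbitrary: f g)
  case 0
  then show ?case by (simp cong: continuous_on_cong)
next
  case (Suc k)
  have g: "(g has_derivative frechet_derivative f (at p)) (at p)" if "p \<in> S" for p
    by (rule has_derivative_transform_within_open
          [OF Ck_on_Suc_has_derivative[OF Suc.prems(1) that] \<open>open S\<close> that Suc.prems(2)])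
  have "Ck_on k S (\<lambda>p. frechet_derivative g (at p) v)" for v
  proof (rule Suc.IH)
    show "Ck_on k S (\<lambda>p. frechet_derivative f (at p) v)"
      using Suc.prems(1) by simp
    show "frechet_derivative f (at p) v = frechet_derivative g (at p) v" if "p \<in> S" for p
      by (simp add: frechet_derivative_at[OF g[OF that]])
  qed
  with g show ?case by (auto intro: differentiableI)
qed

lemma Ck_on_SucI:
  assumes "open S" "\<And>p. p \<in> S \<Longrightarrow> (f has_derivative f' p) (at p)"
    and "\<And>v. Ck_on k S (\<lambda>p. f' p v)"
  shows "Ck_on (Suc k) S f"
proof -
  have "Ck_on k S (\<lambda>p. frechet_derivative f (at p) v)" for v
    by (rule Ck_on_cong[OF assms(1) assms(3)[of v]])
      (simp add: frechet_derivative_at[OF assms(2), symmetric])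
  with assms(2) show ?thesis by (auto intro: differentiableI)
qed

lemma Ck_on_Suc_imp: "Ck_on (Suc k) S f \<Longrightarrow> Ck_on k S f"
proof (induction k arbitrary: f)
  case 0
  then show ?case
    by (auto intro!: continuous_at_imp_continuous_on differentiable_imp_continuous_within)
next
  case (Suc k)
  then show ?case by (metis Ck_on.simps(2))
qed

lemma Ck_on_const: "open S \<Longrightarrow> Ck_on k S (\<lambda>p. c)"
proof (induction k arbitrary: c)
  case (Suc k)
  then show ?case by (intro Ck_on_SucI[where f' = "\<lambda>p v. 0"]) auto
qed simp

lemma Ck_on_add:
  assumes "open S" "Ck_on k S f" "Ck_on k S g"
  shows "Ck_on k S (\<lambda>p. f p + g p)"
  using assms(2,3)
proof (induction k arbitrary: f g)
  case 0
  then show ?case by (simp add: continuous_on_add)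
next
  case (Suc k)
  show ?case
  proof (rule Ck_on_SucI[OF \<open>open S\<close>])
    show "((\<lambda>p. f p + g p) has_derivative
        (\<lambda>v. frechet_derivative f (at p) v + frechet_derivative g (at p) v)) (at p)"
      if "p \<in> S" for p
      using Suc.prems that by (intro has_derivative_add Ck_on_Suc_has_derivative)
    show "Ck_on k S (\<lambda>p. frechet_derivative f (at p) v + frechet_derivative g (at p) v)" for v
      using Suc by simp
  qed
qed

text \<open>The Leibniz rule expresses the derivative by products of the same kind, in which one factor
  is an original map; therefore the induction hypothesis has to cover all pairs of maps.\<close>

lemma Ck_on_bilinear:
  assumes "bounded_bilinear B" "open S" "Ck_on k S f" "Ck_on k S g"
  shows "Ck_on k S (\<lambda>p. B (f p) (g p))"
  using assms(3,4)
proof (induction k arbitrary: f g)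
  case 0
  then show ?case by (simp add: bounded_bilinear.continuous_on[OF assms(1)])
next
  case (Suc k)
  show ?case
  proof (rule Ck_on_SucI[OF \<open>open S\<close>])
    show "((\<lambda>p. B (f p) (g p)) has_derivative
        (\<lambda>v. B (f p) (frechet_derivative g (at p) v) + B (frechet_derivative f (at p) v) (g p)))
        (at p)" if "p \<in> S" for p
      using Suc.prems that
      by (intro bounded_bilinear.FDERIV[OF assms(1)] Ck_on_Suc_has_derivative)
    show "Ck_on k S (\<lambda>p. B (f p) (frechet_derivative g (at p) v)
        + B (frechet_derivative f (at p) v) (g p))" for v
      using Suc.prems
      by (intro Ck_on_add Suc.IH Ck_on_Suc_imp[of k S f] Ck_on_Suc_imp[of k S g] \<open>open S\<close>) auto
  qed
qed

text \<open>The exponent must vary in the induction, because differentiation lowers it. Square roots and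
  reciprocals of positive functions are both covered.\<close>

lemma Ck_on_powr:
  fixes f :: "'a::real_normed_vector \<Rightarrow> real"
  assumes "open S" "Ck_on k S f" "\<And>p. p \<in> S \<Longrightarrow> f p > 0"
  shows "Ck_on k S (\<lambda>p. f p powr a)"
  using assms(2)
proof (induction k arbitrary: a)
  case 0
  have "f p \<noteq> 0" if "p \<in> S" for p using assms(3)[OF that] by simp
  with 0 show ?case by (auto intro!: continuous_on_powr continuous_on_const)
next
  case (Suc k)
  show ?case
  proof (rule Ck_on_SucI[OF \<open>open S\<close>])
    show "((\<lambda>p. f p powr a) has_derivative
        (\<lambda>v. frechet_derivative f (at p) v * (a * f p powr (a - 1)))) (at p)" if "p \<in> S" for p
      using Suc.prems that assms(3)
      by (intro DERIV_compose_FDERIV[of "\<lambda>z. z powr a"] has_real_derivative_powr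
          Ck_on_Suc_has_derivative)
    have "Ck_on k S (\<lambda>p. f p powr (a - 1))"
      using Suc.IH Ck_on_Suc_imp[OF Suc.prems] .
    then show "Ck_on k S (\<lambda>p. frechet_derivative f (at p) v * (a * f p powr (a - 1)))" for v
      using Suc.prems
      by (intro Ck_on_bilinear[OF bounded_bilinear_mult] Ck_on_const \<open>open S\<close>) auto
  qed
qed

section \<open>Smooth maps\<close>

lemma smooth_on_const: "open S \<Longrightarrow> smooth_on S (\<lambda>p. c)"
  by (simp add: smooth_on_def Ck_on_const)

lemma smooth_on_add: "open S \<Longrightarrow> smooth_on S f \<Longrightarrow> smooth_on S g \<Longrightarrow> smooth_on S (\<lambda>p. f p + g p)"
  by (simp add: smooth_on_def Ck_on_add)

lemma smooth_on_bilinear: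
  "bounded_bilinear B \<Longrightarrow> open S \<Longrightarrow> smooth_on S f \<Longrightarrow> smooth_on S g \<Longrightarrow> smooth_on S (\<lambda>p. B (f p) (g p))"
  by (simp add: smooth_on_def Ck_on_bilinear)

lemmas smooth_on_mult = smooth_on_bilinear[OF bounded_bilinear_mult]
lemmas smooth_on_scaleR = smooth_on_bilinear[OF bounded_bilinear_scaleR]

lemma smooth_on_powr:
  fixes f :: "'a::real_normed_vector \<Rightarrow> real"
  shows "open S \<Longrightarrow> smooth_on S f \<Longrightarrow> (\<And>p. p \<in> S \<Longrightarrow> f p > 0) \<Longrightarrow> smooth_on S (\<lambda>p. f p powr a)"
  by (simp add: smooth_on_def Ck_on_powr)

lemma smooth_on_cong:
  "open S \<Longrightarrow> smooth_on S f \<Longrightarrow> (\<And>p. p \<in> S \<Longrightarrow> f p = g p) \<Longrightarrow> smooth_on S g"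
  unfolding smooth_on_def using Ck_on_cong by blast

lemma smooth_on_linear:
  assumes "bounded_linear L" "open S" "smooth_on S f"
  shows "smooth_on S (\<lambda>p. L (f p))"
proof -
  \<comment> \<open>Post-composition with \<open>L\<close> is the product of \<open>f\<close> with the constant \<open>1\<close>.\<close>
  have "bounded_bilinear (\<lambda>r v. r *\<^sub>R L v)"
    by (rule bounded_bilinear.comp[OF bounded_bilinear_scaleR bounded_linear_ident assms(1)])
  from smooth_on_bilinear[OF this assms(2) smooth_on_const[OF assms(2), of 1] assms(3)]
  show ?thesis by simp
qed

lemmas smooth_on_nth = smooth_on_linear[OF bounded_linear_vec_nth]

lemma smooth_on_uminus:
  "open S \<Longrightarrow> smooth_on S f \<Longrightarrow> smooth_on S (\<lambda>p. - f p)"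
  by (rule smooth_on_linear[OF bounded_linear_minus[OF bounded_linear_ident]])

lemma smooth_on_diff:
  "open S \<Longrightarrow> smooth_on S f \<Longrightarrow> smooth_on S g \<Longrightarrow> smooth_on S (\<lambda>p. f p - g p)"
  using smooth_on_add[of S f "\<lambda>p. - g p"] smooth_on_uminus[of S g] by simp

lemma smooth_on_sum:
  "open S \<Longrightarrow> (\<And>i. i \<in> I \<Longrightarrow> smooth_on S (f i)) \<Longrightarrow> smooth_on S (\<lambda>p. \<Sum>i\<in>I. f i p)"
  by (induction I rule: infinite_finite_induct) (simp_all add: smooth_on_const smooth_on_add)

lemma smooth_on_prod:
  fixes f :: "'i \<Rightarrow> 'a::real_normed_vector \<Rightarrow> real"
  shows "open S \<Longrightarrow> (\<And>i. i \<in> I \<Longrightarrow> smooth_on S (f i)) \<Longrightarrow> smooth_on S (\<lambda>p. \<Prod>i\<in>I. f i p)"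
  by (induction I rule: infinite_finite_induct) (simp_all add: smooth_on_const smooth_on_mult)

lemma smooth_on_componentwise:
  fixes f :: "'a::real_normed_vector \<Rightarrow> real^'n"
  assumes "open S" "\<And>j. smooth_on S (\<lambda>p. f p $ j)"
  shows "smooth_on S f"
proof -
  have "smooth_on S (\<lambda>p. \<Sum>j\<in>UNIV. (f p $ j) *\<^sub>R (axis j 1 :: real^'n))"
    by (intro smooth_on_sum smooth_on_scaleR smooth_on_const assms)
  also have "(\<lambda>p. \<Sum>j\<in>UNIV. (f p $ j) *\<^sub>R (axis j 1 :: real^'n)) = f"
    using basis_expansion[where 'a = real and 'n = 'n] by (simp add: fun_eq_iff scalar_mult_eq_scaleR)
  finally show ?thesis .
qed

lemma smooth_on_det:
  fixes A :: "'a::real_normed_vector \<Rightarrow> real^'n^'n"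
  assumes "open S" "\<And>i. smooth_on S (\<lambda>p. A p $ i)"
  shows "smooth_on S (\<lambda>p. det (A p))"
  unfolding det_def
  by (intro smooth_on_sum smooth_on_mult[OF assms(1) smooth_on_const[OF assms(1)]]
      smooth_on_prod smooth_on_nth[OF assms(1) assms(2)] assms(1))

lemma smooth_on_has_derivative:
  "smooth_on S f \<Longrightarrow> p \<in> S \<Longrightarrow> (f has_derivative frechet_derivative f (at p)) (at p)"
  unfolding smooth_on_def using Ck_on_Suc_has_derivative by blast

lemma partial_deriv_eq:
  assumes "(f has_derivative f') (at p)"
  shows "partial_deriv i f p = f' (axis i 1)"
proof -
  have "((\<lambda>t. p + t *\<^sub>R axis i 1) has_derivative (\<lambda>t. t *\<^sub>R axis i 1)) (at 0)"
    by (auto intro!: derivative_eq_intros)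
  then have "((\<lambda>t. f (p + t *\<^sub>R axis i 1)) has_derivative (\<lambda>t. f' (t *\<^sub>R axis i 1))) (at 0)"
    by (rule has_derivative_compose) (simp add: assms)
  then have "((\<lambda>t. f (p + t *\<^sub>R axis i 1)) has_vector_derivative f' (axis i 1)) (at 0)"
    using linear_cmul[OF has_derivative_linear[OF assms]] by (simp add: has_vector_derivative_def)
  then show ?thesis
    unfolding partial_deriv_def by (rule vector_derivative_at)
qed

lemma smooth_on_partial_deriv:
  assumes "open S" "smooth_on S f"
  shows "smooth_on S (partial_deriv i f)"
proof -
  have "smooth_on S (\<lambda>p. frechet_derivative f (at p) (axis i 1))"
    using assms(2) unfolding smooth_on_def by (metis Ck_on.simps(2))
  then show ?thesis
    by (rule smooth_on_cong[OF assms(1)])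
      (metis partial_deriv_eq smooth_on_has_derivative[OF assms(2)])
qed

lemma partial_deriv_linear:
  assumes "bounded_linear L" "(f has_derivative f') (at p)"
  shows "partial_deriv i (\<lambda>p. L (f p)) p = L (partial_deriv i f p)"
  using partial_deriv_eq[OF bounded_linear.has_derivative[OF assms]] partial_deriv_eq[OF assms(2)]
  by simp

section \<open>The pseudo inner product and the pseudo vector products\<close>

lemma bounded_bilinear_pinner:
  "bounded_bilinear (pinner :: real^'n::{finite,one} \<Rightarrow> real^'n::{finite,one} \<Rightarrow> real)"
proof -
  have "bilinear (pinner :: real^'n::{finite,one} \<Rightarrow> real^'n::{finite,one} \<Rightarrow> real)"
    unfolding bilinear_def
    by (intro conjI allI linearI)
      (simp_all add: pinner_def algebra_simps sum.distrib sum_distrib_left)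
  then show ?thesis
    by (simp add: bilinear_conv_bounded_bilinear)
qed

lemmas pinner_linear_simps =
  bounded_bilinear.add_left[OF bounded_bilinear_pinner]
  bounded_bilinear.add_right[OF bounded_bilinear_pinner]
  bounded_bilinear.diff_left[OF bounded_bilinear_pinner]
  bounded_bilinear.diff_right[OF bounded_bilinear_pinner]
  bounded_bilinear.scaleR_left[OF bounded_bilinear_pinner]
  bounded_bilinear.scaleR_right[OF bounded_bilinear_pinner]
  bounded_bilinear.zero_right[OF bounded_bilinear_pinner]

lemmas smooth_on_pinner = smooth_on_bilinear[OF bounded_bilinear_pinner]

lemma pinner_commute: "pinner x y = pinner y x"
  by (simp add: pinner_def mult.commute)

lemma pinner_3: "pinner x y = - x$1 * y$1 + x$2 * y$2 + x$3 * y$3" for x y :: "real^3"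
proof -
  have "UNIV - {1} = {2, 3 :: 3}" using exhaust_3 by auto
  then show ?thesis by (simp add: pinner_def)
qed

lemma pinner_axis:
  "pinner (axis j 1) q = (if j = 1 then - q$j else q$j)" for q :: "real^'n::{finite,one}"
proof -
  have "(\<Sum>k\<in>UNIV - {1}. axis j 1 $ k * q$k) = (\<Sum>k\<in>UNIV - {1}. if k = j then q$k else 0)"
    by (rule sum.cong) (simp_all add: axis_def)
  also have "\<dots> = (if j = 1 then 0 else q$j)"
    by (subst sum.delta) auto
  finally show ?thesis
    by (auto simp: pinner_def axis_def)
qed

text \<open>A vector is determined by its products with the coordinate vectors; for a pseudo vector
  product these are determinants of its factors, hence polynomial in them.\<close>

lemma smooth_on_if_pinner:
  fixes f :: "'a::real_normed_vector \<Rightarrow> real^'n::{finite,one}"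
  assumes "open S" "\<And>w. smooth_on S (\<lambda>p. pinner w (f p))"
  shows "smooth_on S f"
proof (rule smooth_on_componentwise[OF assms(1)])
  fix j :: 'n
  have "(\<lambda>p. f p $ j) = (\<lambda>p. (if j = 1 then -1 else 1) * pinner (axis j 1) (f p))"
    by (simp add: pinner_axis fun_eq_iff)
  then show "smooth_on S (\<lambda>p. f p $ j)"
    using smooth_on_mult[OF assms(1) smooth_on_const[OF assms(1)] assms(2)[of "axis j 1"]] by simp
qed

lemma smooth_on_pwedge4:
  assumes "open S" "smooth_on S f" "smooth_on S g" "smooth_on S h"
  shows "smooth_on S (\<lambda>p. pwedge4 (f p) (g p) (h p))"
proof (rule smooth_on_if_pinner[OF assms(1)])
  fix w
  have "smooth_on S (\<lambda>p. (vector [w, f p, g p, h p] :: real^4^4) $ i)" for i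
    using exhaust_4[of i] assms by (auto simp: vector_4 smooth_on_const)
  then show "smooth_on S (\<lambda>p. pinner w (pwedge4 (f p) (g p) (h p)))"
    unfolding pinner_pwedge4 by (rule smooth_on_det[OF assms(1)])
qed

lemma smooth_on_pwedge3:
  assumes "open S" "smooth_on S f" "smooth_on S g"
  shows "smooth_on S (\<lambda>p. pwedge3 (f p) (g p))"
proof (rule smooth_on_if_pinner[OF assms(1)])
  fix w
  have "smooth_on S (\<lambda>p. (vector [w, f p, g p] :: real^3^3) $ i)" for i
    using exhaust_3[of i] assms by (auto simp: smooth_on_const)
  then show "smooth_on S (\<lambda>p. pinner w (pwedge3 (f p) (g p)))"
    unfolding pinner_pwedge3 by (rule smooth_on_det[OF assms(1)])
qed

lemma pinner_pwedge4_factor: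
  "pinner x (pwedge4 x y z) = 0" "pinner y (pwedge4 x y z) = 0" "pinner z (pwedge4 x y z) = 0"
proof -
  have rows: "row 1 (vector [w, x, y, z] :: real^4^4) = w" "row 2 (vector [w, x, y, z] :: real^4^4) = x"
    "row 3 (vector [w, x, y, z] :: real^4^4) = y" "row 4 (vector [w, x, y, z] :: real^4^4) = z" for w
    by (simp_all add: row_def vector_4)
  show "pinner x (pwedge4 x y z) = 0"
    unfolding pinner_pwedge4 by (rule det_identical_rows[of 1 2]) (simp_all add: rows)
  show "pinner y (pwedge4 x y z) = 0"
    unfolding pinner_pwedge4 by (rule det_identical_rows[of 1 3]) (simp_all add: rows)
  show "pinner z (pwedge4 x y z) = 0"
    unfolding pinner_pwedge4 by (rule det_identical_rows[of 1 4]) (simp_all add: rows)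
qed

lemma pinner_derivative_of_constant_norm:
  assumes "open S" "p \<in> S" "\<And>q. q \<in> S \<Longrightarrow> pinner (f q) (f q) = c" "(f has_derivative f') (at p)"
  shows "pinner (f p) (f' h) = 0"
proof -
  have "((\<lambda>q. pinner (f q) (f q)) has_derivative
      (\<lambda>h. pinner (f p) (f' h) + pinner (f' h) (f p))) (at p)"
    by (rule bounded_bilinear.FDERIV[OF bounded_bilinear_pinner assms(4,4)])
  moreover have "((\<lambda>q. pinner (f q) (f q)) has_derivative (\<lambda>h. 0)) (at p)"
    by (rule has_derivative_transform_within_open[OF has_derivative_const assms(1,2)])
      (simp add: assms(3))
  ultimately have "pinner (f p) (f' h) + pinner (f' h) (f p) = 0"
    by (rule has_derivative_unique[THEN fun_cong])
  then show ?thesis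
    by (simp add: pinner_commute)
qed

section \<open>Linear dependence under the projections\<close>

lemma det_eq_0_iff_rows_dependent:
  fixes A :: "real^'n^'n"
  shows "det A = 0 \<longleftrightarrow> (\<exists>c. (\<Sum>i\<in>UNIV. c i *\<^sub>R A $ i) = 0 \<and> (\<exists>i. c i \<noteq> 0))"
proof -
  have "row i A = A $ i" for i
    by (simp add: row_def)
  then show ?thesis
    using matrix_right_invertible_independent_rows[of A] invertible_det_nz[of A]
      invertible_right_inverse[of A]
    by (simp add: scalar_mult_eq_scaleR) blast
qed

text \<open>In a linear relation between the four vectors, the coefficient of \<open>x\<close> vanishes: multiply the
  relation by \<open>x\<close>. The resulting relation among the other three survives every linear
  map into a three-dimensional space.\<close>

lemma det3_image_eq_0:
  fixes L :: "real^4 \<Rightarrow> real^3" and n x a b :: "real^4"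
  assumes "linear L" and "det (vector [n, x, a, b] :: real^4^4) = 0" and "pinner x x \<noteq> 0"
    and "pinner x n = 0" "pinner x a = 0" "pinner x b = 0"
  shows "det (vector [L n, L a, L b] :: real^3^3) = 0"
proof -
  from assms(2) obtain c :: "4 \<Rightarrow> real"
    where rel: "c 1 *\<^sub>R n + c 2 *\<^sub>R x + c 3 *\<^sub>R a + c 4 *\<^sub>R b = 0" and nz: "\<exists>i. c i \<noteq> 0"
    unfolding det_eq_0_iff_rows_dependent by (auto simp: sum_4 vector_4)
  have "pinner x (c 1 *\<^sub>R n + c 2 *\<^sub>R x + c 3 *\<^sub>R a + c 4 *\<^sub>R b) = 0"
    by (simp only: rel pinner_linear_simps)
  then have "c 2 = 0"
    using assms(3-6) by (simp add: pinner_linear_simps)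
  with nz have "c 1 \<noteq> 0 \<or> c 3 \<noteq> 0 \<or> c 4 \<noteq> 0"
    by (metis exhaust_4)
  define d :: "3 \<Rightarrow> real" where "d i = (if i = 1 then c 1 else if i = 2 then c 3 else c 4)" for i
  have d: "d 1 = c 1" "d 2 = c 3" "d 3 = c 4"
    by (simp_all add: d_def)
  have "L (c 1 *\<^sub>R n + c 3 *\<^sub>R a + c 4 *\<^sub>R b) = 0"
    using rel \<open>c 2 = 0\<close> linear_0[OF assms(1)] by simp
  then have "d 1 *\<^sub>R L n + d 2 *\<^sub>R L a + d 3 *\<^sub>R L b = 0"
    by (simp add: d linear_add[OF assms(1)] linear_cmul[OF assms(1)])
  moreover have "\<exists>i. d i \<noteq> 0"
    using \<open>c 1 \<noteq> 0 \<or> c 3 \<noteq> 0 \<or> c 4 \<noteq> 0\<close> d by metis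
  ultimately show ?thesis
    unfolding det_eq_0_iff_rows_dependent by (auto simp: sum_3 intro!: exI[of _ d])
qed

lemma bounded_linear_mproj:
  assumes "i \<in> {2, 3, 4}"
  shows "bounded_linear (mproj i)"
proof -
  have "linear (mproj i)"
    using assms by (auto intro!: linearI simp: mproj_def vec_eq_iff forall_3)
  then show ?thesis
    by (rule linear_conv_bounded_linear[THEN iffD1])
qed

section \<open>Lightlike frames orthogonal to a spacelike vector\<close>

text \<open>The orthogonal complement of a spacelike vector \<open>n\<close> is a Lorentzian plane. It contains the
  horizontal vector \<open>(0, -n\<^sub>3, n\<^sub>2)\<close> and, orthogonal to it, the projection of the time axis, which is a
  multiple of \<open>(n\<^sub>2\<^sup>2 + n\<^sub>3\<^sup>2, n\<^sub>1 n\<^sub>2, n\<^sub>1 n\<^sub>3)\<close>. The frame consists of these two vectors, normalized. The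
  radicands are positive because \<open>n\<^sub>2\<^sup>2 + n\<^sub>3\<^sup>2 > n\<^sub>1\<^sup>2\<close>, so that the frame depends smoothly on \<open>n\<close>.\<close>

definition radius2 :: "real^3 \<Rightarrow> real" where
  "radius2 n = (n$2)^2 + (n$3)^2"

definition frame_time :: "real^3 \<Rightarrow> real^3" where
  "frame_time n = ((radius2 n * pinner n n) powr (-1/2)) *\<^sub>R vector [radius2 n, n$1 * n$2, n$1 * n$3]"

definition frame_space :: "real^3 \<Rightarrow> real^3" where
  "frame_space n = (radius2 n powr (-1/2)) *\<^sub>R vector [0, - n$3, n$2]"

lemma pinner_self_eq: "pinner n n = radius2 n - (n$1)^2"
  by (simp add: pinner_3 radius2_def power2_eq_square)

lemma radius2_pos: "spacelike n \<Longrightarrow> radius2 n > 0"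
  using zero_le_power2[of "n$1"] unfolding spacelike_def pinner_self_eq by linarith

lemma inverse_sqrt_square: "(a powr (-1/2)) * (a powr (-1/2)) * a = 1" if "a > 0" for a :: real
proof -
  have "(a powr (-1/2)) * (a powr (-1/2)) * a powr 1 = a powr 0"
    by (simp only: powr_add[symmetric]) simp
  then show ?thesis using that by simp
qed

lemma frame_orthonormal:
  assumes "spacelike n"
  shows "pinner (frame_time n) (frame_time n) = -1" "pinner (frame_space n) (frame_space n) = 1"
    "pinner (frame_time n) (frame_space n) = 0"
proof -
  note r = radius2_pos[OF assms]
  have q: "radius2 n * pinner n n > 0"
    using assms r by (simp add: spacelike_def)
  have "pinner (vector [radius2 n, n$1 * n$2, n$1 * n$3] :: real^3)
      (vector [radius2 n, n$1 * n$2, n$1 * n$3]) = - (radius2 n * pinner n n)"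
    by (simp add: pinner_3 radius2_def power2_eq_square algebra_simps)
  then show "pinner (frame_time n) (frame_time n) = -1"
    using inverse_sqrt_square[OF q] by (simp add: frame_time_def pinner_linear_simps)
  have "pinner (vector [0, - n$3, n$2] :: real^3) (vector [0, - n$3, n$2]) = radius2 n"
    by (simp add: pinner_3 radius2_def power2_eq_square)
  then show "pinner (frame_space n) (frame_space n) = 1"
    using inverse_sqrt_square[OF r] by (simp add: frame_space_def pinner_linear_simps)
  show "pinner (frame_time n) (frame_space n) = 0"
    by (simp add: frame_time_def frame_space_def pinner_3 algebra_simps)
qed

lemma orthogonal_to_frame_eq_0:
  assumes "spacelike n" and "pinner n d = 0"
    and "pinner (frame_time n) d = 0" "pinner (frame_space n) d = 0"
  shows "d = 0"
proof -
  note r = radius2_pos[OF assms(1)]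
  have q: "pinner n n \<noteq> 0"
    using assms(1) by (simp add: spacelike_def)
  have n: "n$2 * d$2 + n$3 * d$3 = n$1 * d$1"
    using assms(2) by (simp add: pinner_3)
  have "pinner (vector [radius2 n, n$1 * n$2, n$1 * n$3]) d = 0"
    using assms(3) r q unfolding frame_time_def pinner_linear_simps by simp
  then have "n$1 * (n$2 * d$2 + n$3 * d$3) = radius2 n * d$1"
    by (simp add: pinner_3 algebra_simps)
  then have "pinner n n * d$1 = 0"
    unfolding n pinner_self_eq by (auto simp: algebra_simps power2_eq_square)
  with q have d1: "d$1 = 0" by simp
  have "pinner (vector [0, - n$3, n$2]) d = 0"
    using assms(4) r unfolding frame_space_def pinner_linear_simps by simp
  then have s: "n$2 * d$3 = n$3 * d$2"
    by (simp add: pinner_3)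
  have "radius2 n * d$2 = n$2 * (n$2 * d$2 + n$3 * d$3) + n$3 * (n$3 * d$2 - n$2 * d$3)"
    "radius2 n * d$3 = n$3 * (n$2 * d$2 + n$3 * d$3) + n$2 * (n$2 * d$3 - n$3 * d$2)"
    by (simp_all add: radius2_def power2_eq_square algebra_simps)
  then have "radius2 n * d$2 = 0" "radius2 n * d$3 = 0"
    by (simp_all add: n d1 s)
  with r d1 show ?thesis
    by (simp add: vec_eq_iff forall_3)
qed

lemma frame_orthogonal:
  "pinner n (frame_time n) = 0" "pinner n (frame_space n) = 0"
  by (simp_all add: frame_time_def frame_space_def pinner_3 radius2_def power2_eq_square algebra_simps)

text \<open>By non-degeneracy of the form it suffices to compare products with \<open>n\<close> and the frame. The
  minus sign comes from the timelike vector, whose square is \<open>-1\<close>.\<close>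

lemma frame_expansion:
  assumes "spacelike n" "pinner n w = 0"
  shows "w = pinner w (frame_space n) *\<^sub>R frame_space n - pinner w (frame_time n) *\<^sub>R frame_time n"
proof -
  let ?t = "frame_time n" and ?s = "frame_space n"
  have "w - (pinner w ?s *\<^sub>R ?s - pinner w ?t *\<^sub>R ?t) = 0"
    using assms frame_orthonormal[OF assms(1)] frame_orthogonal[of n]
    by (intro orthogonal_to_frame_eq_0[OF assms(1)])
      (simp_all add: pinner_linear_simps pinner_commute[of ?s ?t] pinner_commute[of ?s w]
        pinner_commute[of ?t w])
  then show ?thesis by simp
qed

text \<open>The squares of \<open>t\<close> and \<open>s\<close> cancel in the squares of \<open>t \<plusminus> s\<close> and add up in their product.\<close>

lemma lightlike_sum_diff_in_Delta4:
  assumes "pinner t t = -1" "pinner s s = 1" "pinner t s = 0"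
  shows "(t + s, t - s) \<in> Delta4"
proof -
  have st: "pinner s t = 0" using assms(3) by (simp add: pinner_commute)
  have "pinner (t + s) (t - s) = -2" "pinner (t + s) (t + s) = 0" "pinner (t - s) (t - s) = 0"
    using assms st by (simp_all add: pinner_linear_simps)
  moreover from this(1) have "t + s \<noteq> 0" "t - s \<noteq> 0"
    by (metis bounded_bilinear.zero_left bounded_bilinear.zero_right bounded_bilinear_pinner
        zero_neq_neg_numeral)+
  ultimately show ?thesis
    by (simp add: Delta4_def LCstar_def)
qed

lemma smooth_on_frame:
  assumes "open S" "smooth_on S n" "\<And>p. p \<in> S \<Longrightarrow> spacelike (n p)"
  shows "smooth_on S (\<lambda>p. frame_time (n p))" "smooth_on S (\<lambda>p. frame_space (n p))"
proof -
  note intros = smooth_on_mult smooth_on_add smooth_on_const smooth_on_uminus smooth_on_nth assms(1,2)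
  have r: "smooth_on S (\<lambda>p. radius2 (n p))"
    unfolding radius2_def power2_eq_square by (intro intros)
  have rq: "smooth_on S (\<lambda>p. radius2 (n p) * pinner (n p) (n p))"
    by (intro smooth_on_mult smooth_on_pinner r assms(1,2))
  have vec: "smooth_on S (\<lambda>p. vector [a p, b p, c p] :: real^3)"
    if "smooth_on S a" "smooth_on S b" "smooth_on S c" for a b c :: "'a \<Rightarrow> real"
  proof (rule smooth_on_componentwise[OF assms(1)])
    show "smooth_on S (\<lambda>p. (vector [a p, b p, c p] :: real^3) $ j)" for j
      using exhaust_3[of j] that by auto
  qed
  show "smooth_on S (\<lambda>p. frame_time (n p))"
    unfolding frame_time_def
    using assms(3) radius2_pos[OF assms(3)]
    by (intro smooth_on_scaleR smooth_on_powr rq vec r intros) (auto simp: spacelike_def)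
  show "smooth_on S (\<lambda>p. frame_space (n p))"
    unfolding frame_space_def
    by (intro smooth_on_scaleR smooth_on_powr vec r radius2_pos[OF assms(3)] intros)
qed

section \<open>Projections of hyperbolic generalized framed surfaces\<close>

text \<open>The pseudo vector product lies in the Lorentzian plane orthogonal to \<open>n\<close>, which is spanned by
  the lightlike sum and difference of the two frame vectors.\<close>

lemma lightcone_framed_base_surfaceI:
  fixes n y :: "real^2 \<Rightarrow> real^3"
  assumes "open U" "smooth_on U y" "smooth_on U n" "\<And>p. p \<in> U \<Longrightarrow> spacelike (n p)"
    and orth: "\<And>p. p \<in> U \<Longrightarrow> pinner (n p) (pwedge3 (deriv_u y p) (deriv_v y p)) = 0"
  shows "lightcone_framed_base_surface U y"
proof -
  define t where "t p = frame_time (n p)" for p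
  define s where "s p = frame_space (n p)" for p
  define w where "w p = pwedge3 (deriv_u y p) (deriv_v y p)" for p
  have sm: "smooth_on U t" "smooth_on U s"
    using smooth_on_frame[OF assms(1,3,4)] by (simp_all add: t_def[abs_def] s_def[abs_def])
  have w: "smooth_on U w"
    unfolding w_def[abs_def] using assms(1,2) by (intro smooth_on_pwedge3 smooth_on_partial_deriv)
  have "(t p + s p, t p - s p) \<in> Delta4" if "p \<in> U" for p
    using frame_orthonormal[OF assms(4)[OF that]]
    unfolding t_def s_def by (rule lightlike_sum_diff_in_Delta4)
  \<comment> \<open>As \<open>l\<^sup>+\<close> and \<open>l\<^sup>-\<close> are lightlike with product \<open>-2\<close>, the coefficient of each is \<open>-1/2\<close> times the
    product with the other.\<close>
  moreover have "w p = ((- 1/2) * pinner (w p) (t p - s p)) *\<^sub>R (t p + s p)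
      + ((- 1/2) * pinner (w p) (t p + s p)) *\<^sub>R (t p - s p)" if "p \<in> U" for p
  proof -
    have exp: "w p = pinner (w p) (s p) *\<^sub>R s p - pinner (w p) (t p) *\<^sub>R t p"
      unfolding t_def s_def using assms(4) orth that
      by (intro frame_expansion) (simp_all add: w_def)
    have "((- 1/2) * (b - a)) *\<^sub>R (t p + s p) + ((- 1/2) * (b + a)) *\<^sub>R (t p - s p)
        = a *\<^sub>R s p - b *\<^sub>R t p" for a b
      by (simp add: vec_eq_iff field_simps)
    then show ?thesis
      unfolding pinner_linear_simps using exp by simp
  qed
  moreover have "smooth_on U (\<lambda>p. (- 1/2) * pinner (w p) (t p - s p))"
    "smooth_on U (\<lambda>p. (- 1/2) * pinner (w p) (t p + s p))"
    by (intro smooth_on_mult smooth_on_const smooth_on_pinner smooth_on_add smooth_on_diff sm w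
        assms(1))+
  moreover have "smooth_on U (\<lambda>p. t p + s p)" "smooth_on U (\<lambda>p. t p - s p)"
    by (intro smooth_on_add smooth_on_diff sm assms(1))+
  ultimately show ?thesis
    unfolding lightcone_framed_base_surface_def lightcone_framed_surface_def
    using assms(2) unfolding w_def by blast
qed

theorem proposition4p3:
  fixes U :: "(real^2) set"
    and x \<nu>1 \<nu>2 \<nu>3 :: "real^2 \<Rightarrow> real^4"
    and i :: nat
  assumes "open U" and "simply_connected U"
    and "hyperbolic_gen_framed_surface U x \<nu>1 \<nu>2"
    and "\<And>p. p \<in> U \<Longrightarrow> \<nu>3 p = pwedge4 (x p) (\<nu>1 p) (\<nu>2 p)"
    and "i \<in> {2, 3, 4}"
    and "\<And>p. p \<in> U \<Longrightarrow> spacelike ((mproj i \<circ> \<nu>3) p)"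
  shows "lightcone_framed_base_surface U (mproj i \<circ> x)"
proof (rule lightcone_framed_base_surfaceI[where n = "mproj i \<circ> \<nu>3"])
  from assms(3) obtain \<alpha> \<beta> :: "real^2 \<Rightarrow> real"
    where sm: "smooth_on U x" "smooth_on U \<nu>1" "smooth_on U \<nu>2"
      and H: "\<And>p. p \<in> U \<Longrightarrow> pinner (x p) (x p) = -1"
      and wedge: "\<And>p. p \<in> U \<Longrightarrow>
        pwedge4 (x p) (deriv_u x p) (deriv_v x p) = \<alpha> p *\<^sub>R \<nu>1 p + \<beta> p *\<^sub>R \<nu>2 p"
    unfolding hyperbolic_gen_framed_surface_def H3_def by blast
  note L = bounded_linear_mproj[OF assms(5)]
  show "smooth_on U (mproj i \<circ> x)"
    unfolding comp_def using L assms(1) sm(1) by (rule smooth_on_linear)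
  have "smooth_on U \<nu>3"
    by (rule smooth_on_cong[OF assms(1) smooth_on_pwedge4[OF assms(1) sm]]) (simp add: assms(4))
  then show "smooth_on U (mproj i \<circ> \<nu>3)"
    unfolding comp_def by (rule smooth_on_linear[OF L assms(1)])
  fix p assume p: "p \<in> U"
  note Dx = smooth_on_has_derivative[OF sm(1) p]
  have "pinner (\<nu>3 p) (\<nu>1 p) = 0" "pinner (\<nu>3 p) (\<nu>2 p) = 0" and x3: "pinner (x p) (\<nu>3 p) = 0"
    unfolding assms(4)[OF p] by (simp_all only: pinner_pwedge4_factor pinner_commute[of "pwedge4 _ _ _"])
  then have "pinner (\<nu>3 p) (pwedge4 (x p) (deriv_u x p) (deriv_v x p)) = 0"
    by (simp add: wedge[OF p] pinner_linear_simps)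
  then have "det (vector [\<nu>3 p, x p, deriv_u x p, deriv_v x p] :: real^4^4) = 0"
    by (simp only: pinner_pwedge4)
  moreover have "pinner (x p) (partial_deriv j x p) = 0" for j
    unfolding partial_deriv_eq[OF Dx]
    by (rule pinner_derivative_of_constant_norm[OF assms(1) p H Dx])
  ultimately have
    "det (vector [mproj i (\<nu>3 p), mproj i (deriv_u x p), mproj i (deriv_v x p)] :: real^3^3) = 0"
    by (intro det3_image_eq_0[where x = "x p"] bounded_linear.linear[OF L]) (simp_all add: H[OF p] x3)
  then show "pinner ((mproj i \<circ> \<nu>3) p)
      (pwedge3 (deriv_u (mproj i \<circ> x) p) (deriv_v (mproj i \<circ> x) p)) = 0"
    by (simp add: pinner_pwedge3 partial_deriv_linear[OF L Dx] comp_def)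
qed (use assms in auto)

end
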